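(* Let $(S_O,P_O)$ be a deductive source with irredundant core $A=\mathrm{Atom}(S_O)$ and redundant part $J=S_O\setminus A$, and assume the reconstruction alphabet satisfies $\hat S_O\subseteq\mathrm{Cn}(S_O)\cap\mathbb{S}_O$. Then, for every $D\ge 0$, $$R_{\mathrm{sem}}(D;d_{\mathrm{Cn}},P_O)=P_A\cdot R^{(A)}\Bigl(\frac{D}{P_A};d_{\mathrm{Cn}},\pi_A\Bigr),$$ with the convention that the right-hand side is $0$ when $P_A=0$. In particular: (i) under the additional hypotheses that $A\subseteq\hat S_O$ and that $R_{\mathrm{Cn}}(a_1)\cap R_{\mathrm{Cn}}(a_2)=\varnothing$ for all distinct $a_1,a_2\in A$, one has $R_{\mathrm{sem}}(0;d_{\mathrm{Cn}},P_O)=P_AH(\pi_A)$ (read as $0$ when $P_A=0$); (ii) the function $D\mapsto R_{\mathrm{sem}}(D;d_{\mathrm{Cn}},P_O)$ is convex, non-increasing, and reducible to a finite-alphabet core problem (namely the one defining $R^{(A)}$) that is amenable to standard numerical evaluation; (iii) redundant states (the elements of $J$) are invisible to both rate and distortion.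
   Context: Setting. $\mathbb{S}_O$ is a finite set of statements with a fixed proof system with decidable derivability; $\mathrm{Cn}(\Gamma)\subseteq\mathbb{S}_O$ denotes the set of statements derivable from $\Gamma\subseteq\mathbb{S}_O$. $\mathrm{Cn}$ is reflexive ($\Gamma\subseteq\mathrm{Cn}(\Gamma)$), monotone ($\Gamma\subseteq\Gamma'\Rightarrow\mathrm{Cn}(\Gamma)\subseteq\mathrm{Cn}(\Gamma')$) and idempotent ($\mathrm{Cn}(\mathrm{Cn}(\Gamma))=\mathrm{Cn}(\Gamma)$). $S_O\subseteq\mathbb{S}_O$ is a finite knowledge base with a fixed linear (canonical) order, $\hat S_O\subseteq\mathbb{S}_O$ is a nonempty finite reconstruction alphabet, and a deductive source is a pair $(S_O,P_O)$ with $P_O$ a probability distribution on $S_O$. Core. $\mathrm{Atom}(S_O)$ is the output of the deletion procedure: start with $B=S_O$; scan the elements $s$ of $S_O$ in the canonical order; whenever the scanned $s$ satisfies $s\in\mathrm{Cn}(B\setminus\{s\})$ for the current $B$, remove $s$ from $B$; the final $B$ is $\mathrm{Atom}(S_O)$. Put $A=\mathrm{Atom}(S_O)$ (the irredundant core), $J=S_O\setminus A$ (the redundant part, whose elements are the redundant states), $P_A=P_O(A)$ and, if $P_A>0$, $\pi_A(a)=P_O(a)/P_A$ for $a\in A$. Closure distortion. For $s\in S_O$, $\hat s\in\hat S_O$, let $C_s=\mathrm{Cn}((S_O\setminus\{s\})\cup\{s\})=\mathrm{Cn}(S_O)$ and $C_{\hat s}=\mathrm{Cn}((S_O\setminus\{s\})\cup\{\hat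 s\})$; then $d_{\mathrm{Cn}}(s,\hat s)=1-|C_s\cap C_{\hat s}|/|C_s\cup C_{\hat s}|$, with distortion $0$ when both closure sets are empty. For $s\in S_O$, $R_{\mathrm{Cn}}(s)=\{\hat s\in\hat S_O: d_{\mathrm{Cn}}(s,\hat s)=0\}$. Rate–distortion functions. $R_{\mathrm{sem}}(D;d_{\mathrm{Cn}},P_O)$ is the minimum of the mutual information $I(\mathsf S_o;\hat{\mathsf S}_o)$ over all test channels $P_{\hat S\mid S}$ from $S_O$ to $\hat S_O$ with $\mathbb{E}[d_{\mathrm{Cn}}(\mathsf S_o,\hat{\mathsf S}_o)]\le D$, where $\mathsf S_o\sim P_O$ and $\hat{\mathsf S}_o\sim P_{\hat S\mid S}(\cdot\mid\mathsf S_o)$. For $P_A>0$, the core sub-source rate–distortion function $R^{(A)}(D';d_{\mathrm{Cn}},\pi_A)$ is the minimum of $I(\mathsf A_o;\hat{\mathsf S}_o)$ over test channels $P_{\hat S\mid A}$ from $A$ to $\hat S_O$ with $\mathbb{E}[d_{\mathrm{Cn}}(\mathsf A_o,\hat{\mathsf S}_o)]\le D'$, where $\mathsf A_o\sim\pi_A$ and $d_{\mathrm{Cn}}$ is the same distortion (relative to the full $S_O$) restricted to inputs in $A$. Both are $+\infty$ when the constraint set is empty. $H$ is Shannon entropy. *)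

theory Defs
  imports "HOL-Probability.Probability"
begin

text \<open>
  The finite set of all statements is the type \<open>'s\<close> (of class \<open>finite\<close>), and derivability is
  represented by its consequence operator \<open>Cn\<close>; decidability is automatic on a finite set.
\<close>

definition consequence_operator :: "('s set \<Rightarrow> 's set) \<Rightarrow> bool" where
  "consequence_operator Cn \<longleftrightarrow>
     (\<forall>\<Gamma>. \<Gamma> \<subseteq> Cn \<Gamma>) \<and>
     (\<forall>\<Gamma> \<Gamma>'. \<Gamma> \<subseteq> \<Gamma>' \<longrightarrow> Cn \<Gamma> \<subseteq> Cn \<Gamma>') \<and>
     (\<forall>\<Gamma>. Cn (Cn \<Gamma>) = Cn \<Gamma>)"

text \<open>
  A knowledge base together with its canonical order is a distinct list \<open>S\<close>: the underlying
  set is \<open>set S\<close>, and the list is scanned from left to right.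
\<close>

definition deletion_step :: "('s set \<Rightarrow> 's set) \<Rightarrow> 's \<Rightarrow> 's set \<Rightarrow> 's set" where
  "deletion_step Cn s B = (if s \<in> Cn (B - {s}) then B - {s} else B)"

definition Atom :: "('s set \<Rightarrow> 's set) \<Rightarrow> 's list \<Rightarrow> 's set" where
  "Atom Cn S = fold (deletion_step Cn) S (set S)"

definition redundant_part :: "('s set \<Rightarrow> 's set) \<Rightarrow> 's list \<Rightarrow> 's set" where
  "redundant_part Cn S = set S - Atom Cn S"

definition replaced_closure :: "('s set \<Rightarrow> 's set) \<Rightarrow> 's set \<Rightarrow> 's \<Rightarrow> 's \<Rightarrow> 's set" where
  "replaced_closure Cn K s t = Cn ((K - {s}) \<union> {t})"

definition d_Cn :: "('s set \<Rightarrow> 's set) \<Rightarrow> 's set \<Rightarrow> 's \<Rightarrow> 's \<Rightarrow> real" where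
  "d_Cn Cn K s t =
     (let C = replaced_closure Cn K s s; C' = replaced_closure Cn K s t
      in if C = {} \<and> C' = {} then 0
         else 1 - real (card (C \<inter> C')) / real (card (C \<union> C')))"

definition R_Cn :: "('s set \<Rightarrow> 's set) \<Rightarrow> 's set \<Rightarrow> 's set \<Rightarrow> 's \<Rightarrow> 's set" where
  "R_Cn Cn K Shat s = {t \<in> Shat. d_Cn Cn K s t = 0}"

text \<open>
  A test channel from \<open>X\<close> to \<open>Y\<close> is a stochastic kernel. Its values outside \<open>X\<close> are unconstrained
  and never matter, because it is only used with input distributions supported in \<open>X\<close>.
\<close>

definition test_channels :: "'x set \<Rightarrow> 'y set \<Rightarrow> ('x \<Rightarrow> 'y pmf) set" where
  "test_channels X Y = {W. \<forall>x\<in>X. set_pmf (W x) \<subseteq> Y}"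

definition joint_pmf :: "'x pmf \<Rightarrow> ('x \<Rightarrow> 'y pmf) \<Rightarrow> ('x \<times> 'y) pmf" where
  "joint_pmf p W = bind_pmf p (\<lambda>x. map_pmf (Pair x) (W x))"

text \<open>The parameter \<open>b\<close> is the base of the logarithm, i.e. the unit of information.\<close>

definition mutual_info :: "real \<Rightarrow> 'x pmf \<Rightarrow> ('x \<Rightarrow> 'y pmf) \<Rightarrow> real" where
  "mutual_info b p W =
     prob_space.mutual_information (measure_pmf (joint_pmf p W)) b
       (count_space UNIV) (count_space UNIV) fst snd"

definition entropy_pmf :: "real \<Rightarrow> 'x pmf \<Rightarrow> real" where
  "entropy_pmf b p = prob_space.entropy (measure_pmf p) b (count_space UNIV) (\<lambda>x. x)"

definition expected_distortion ::
    "('x \<Rightarrow> 'y \<Rightarrow> real) \<Rightarrow> 'x pmf \<Rightarrow> ('x \<Rightarrow> 'y pmf) \<Rightarrow> real" where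
  "expected_distortion d p W = measure_pmf.expectation (joint_pmf p W) (\<lambda>(x, y). d x y)"

definition feasible_channels ::
    "('x \<Rightarrow> 'y \<Rightarrow> real) \<Rightarrow> 'x pmf \<Rightarrow> 'x set \<Rightarrow> 'y set \<Rightarrow> real \<Rightarrow> ('x \<Rightarrow> 'y pmf) set" where
  "feasible_channels d p X Y D = {W \<in> test_channels X Y. expected_distortion d p W \<le> D}"

text \<open>As an infimum in the extended reals, this is \<open>\<infinity>\<close> if no channel is feasible.\<close>

definition rate_distortion ::
    "real \<Rightarrow> ('x \<Rightarrow> 'y \<Rightarrow> real) \<Rightarrow> 'x pmf \<Rightarrow> 'x set \<Rightarrow> 'y set \<Rightarrow> real \<Rightarrow> ereal" where
  "rate_distortion b d p X Y D = (INF W\<in>feasible_channels d p X Y D. ereal (mutual_info b p W))"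

definition mix_channel :: "real \<Rightarrow> ('x \<Rightarrow> 'y pmf) \<Rightarrow> ('x \<Rightarrow> 'y pmf) \<Rightarrow> 'x \<Rightarrow> 'y pmf" where
  "mix_channel t V W x = bind_pmf (bernoulli_pmf t) (\<lambda>c. if c then V x else W x)"

definition R_sem ::
    "real \<Rightarrow> ('s set \<Rightarrow> 's set) \<Rightarrow> 's list \<Rightarrow> 's set \<Rightarrow> 's pmf \<Rightarrow> real \<Rightarrow> ereal" where
  "R_sem b Cn S Shat P D = rate_distortion b (d_Cn Cn (set S)) P (set S) Shat D"

definition P_core :: "('s set \<Rightarrow> 's set) \<Rightarrow> 's list \<Rightarrow> 's pmf \<Rightarrow> real" where
  "P_core Cn S P = measure_pmf.prob P (Atom Cn S)"

text \<open>Only meaningful if \<open>P_core Cn S P > 0\<close>, as is everything defined from it.\<close>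

definition pi_core :: "('s set \<Rightarrow> 's set) \<Rightarrow> 's list \<Rightarrow> 's pmf \<Rightarrow> 's pmf" where
  "pi_core Cn S P = cond_pmf P (Atom Cn S)"

definition R_core ::
    "real \<Rightarrow> ('s set \<Rightarrow> 's set) \<Rightarrow> 's list \<Rightarrow> 's set \<Rightarrow> 's pmf \<Rightarrow> real \<Rightarrow> ereal" where
  "R_core b Cn S Shat P D =
     rate_distortion b (d_Cn Cn (set S)) (pi_core Cn S P) (Atom Cn S) Shat D"

end

theory Submission
  imports Defs "HOL-Real_Asymp.Real_Asymp"
begin

text \<open>A redundant state \<open>s\<close> is derivable from the other statements, so replacing it by anything
  derivable leaves the closure unchanged: its distortion is identically \<open>0\<close>. Writing mutual
  information as an average divergence from the output marginal, Topsoe's compensation identity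
  shows that restricting a channel to the core costs at least \<open>P\<^sub>A\<close> times the core information, and
  equality holds if redundant inputs draw their output from the core's output marginal. The minima
  are attained by compactness of the set of stochastic matrices.\<close>

subsection \<open>Mutual information as average divergence\<close>

text \<open>Against a fixed reference law, average divergence is a sum over inputs and splits along
  any set of inputs. Mutual information does not split directly, because its reference law is the
  output marginal, which depends on all inputs. Compensation controls exactly this: replacing a
  channel's own marginal by another law only adds a divergence. Attainment also serves convexity in
  \<open>D\<close> and the upper bound of the core reduction, which start from optimal channels;
  infeasible budgets give \<open>\<infinity>\<close> and are treated apart. The deletion procedure
  certifies a redundant state only against the set current at its removal; monotonicity lifts this
  to all the other statements.\<close>

lemma pmf_bind_finite:
  fixes p :: "('x::finite) pmf"
  shows "pmf (bind_pmf p W) y = (\<Sum>x\<in>UNIV. pmf p x * pmf (W x) y)"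
  by (simp add: pmf_bind integral_measure_pmf[of UNIV])

lemma sum_pmf_UNIV: "(\<Sum>x\<in>UNIV. pmf p x) = 1" for p :: "('x::finite) pmf"
  by (simp add: sum_pmf_eq_1)

lemma pmf_joint: "pmf (joint_pmf p W) (x, y) = pmf p x * pmf (W x) y"
  for p :: "('x::finite) pmf"
proof -
  have "pmf (map_pmf (Pair x') (W x')) (x, y) = (if x' = x then pmf (W x) y else 0)" for x'
    by (auto simp: pmf_map_inj' inj_def pmf_eq_0_set_pmf)
  then have "pmf (joint_pmf p W) (x, y) = (\<Sum>x'\<in>UNIV. if x' = x then pmf p x * pmf (W x) y else 0)"
    unfolding joint_pmf_def pmf_bind_finite by (intro sum.cong) auto
  then show ?thesis by simp
qed

lemma map_fst_joint_pmf: "map_pmf fst (joint_pmf p W) = p"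
  by (simp add: joint_pmf_def map_bind_pmf pmf.map_comp o_def map_pmf_const bind_return_pmf')

lemma map_snd_joint_pmf: "map_pmf snd (joint_pmf p W) = bind_pmf p W"
  by (simp add: joint_pmf_def map_bind_pmf pmf.map_comp o_def)

lemma expected_distortion_eq_sum:
  fixes p :: "('x::finite) pmf" and W :: "'x \<Rightarrow> ('y::finite) pmf"
  shows "expected_distortion d p W = (\<Sum>x\<in>UNIV. pmf p x * (\<Sum>y\<in>UNIV. pmf (W x) y * d x y))"
proof -
  have "expected_distortion d p W = (\<Sum>z\<in>UNIV \<times> UNIV. pmf (joint_pmf p W) z * (case z of (x, y) \<Rightarrow> d x y))"
    by (simp add: expected_distortion_def integral_measure_pmf[of UNIV])
  also have "\<dots> = (\<Sum>x\<in>UNIV. \<Sum>y\<in>UNIV. pmf (joint_pmf p W) (x, y) * d x y)"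
    by (subst sum.cartesian_product) (simp add: case_prod_beta)
  finally show ?thesis
    by (simp add: pmf_joint sum_distrib_left mult.assoc)
qed

text \<open>Relative entropy. Where \<open>v\<close> vanishes and \<open>u\<close> does not,
  division by zero yields a finite term instead of \<infinity>; hence the support inclusions assumed
  for nonnegativity and compensation.\<close>

definition kl_pmf :: "real \<Rightarrow> 'y pmf \<Rightarrow> 'y pmf \<Rightarrow> real" where
  "kl_pmf b u v = (\<Sum>y\<in>UNIV. pmf u y * log b (pmf u y / pmf v y))"

text \<open>The factor \<open>pmf p x\<close> cancels in the ratio of the joint law to the product
  of its marginals; where it is 0, both sides carry the weight 0.\<close>

lemma mutual_info_eq_sum_kl:
  fixes p :: "('x::finite) pmf" and W :: "'x \<Rightarrow> ('y::finite) pmf"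
  assumes "1 < b"
  shows "mutual_info b p W = (\<Sum>x\<in>UNIV. pmf p x * kl_pmf b (W x) (bind_pmf p W))"
proof -
  let ?J = "joint_pmf p W" and ?q = "bind_pmf p W"
  interpret information_space "measure_pmf ?J" b
    using assms by unfold_locales
  have C: "count_space (UNIV::'x set) \<Otimes>\<^sub>M count_space (UNIV::'y set) = count_space UNIV"
    by (simp add: pair_measure_countable)
  have X: "distributed (measure_pmf ?J) (count_space UNIV) fst (\<lambda>x. ennreal (pmf p x))"
    using map_pmf_rep_eq[of fst ?J] measure_pmf_eq_density[of p]
    by (simp add: distributed_def map_fst_joint_pmf)
  have Y: "distributed (measure_pmf ?J) (count_space UNIV) snd (\<lambda>y. ennreal (pmf ?q y))"
    using map_pmf_rep_eq[of snd ?J] measure_pmf_eq_density[of ?q]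
    by (simp add: distributed_def map_snd_joint_pmf)
  have XY: "distributed (measure_pmf ?J) (count_space UNIV \<Otimes>\<^sub>M count_space UNIV)
      (\<lambda>z. (fst z, snd z)) (\<lambda>z. ennreal (pmf ?J z))"
    using map_pmf_rep_eq[of id ?J] measure_pmf_eq_density[of ?J]
    by (simp add: distributed_def C id_def)
  have "mutual_info b p W = (\<integral>z. pmf ?J z * log b (pmf ?J z / (pmf p (fst z) * pmf ?q (snd z)))
      \<partial>(count_space UNIV \<Otimes>\<^sub>M count_space UNIV))"
    unfolding mutual_info_def
    using mutual_information_distr[OF _ _ X _ Y _ XY]
    by (simp add: sigma_finite_measure_count_space_finite case_prod_beta)
  also have "\<dots> = (\<Sum>z\<in>UNIV \<times> UNIV. pmf ?J z * log b (pmf ?J z / (pmf p (fst z) * pmf ?q (snd z))))"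
    by (simp add: C lebesgue_integral_count_space_finite)
  also have "\<dots> = (\<Sum>x\<in>UNIV. \<Sum>y\<in>UNIV. pmf ?J (x, y) * log b (pmf ?J (x, y) / (pmf p x * pmf ?q y)))"
    by (subst sum.cartesian_product) (simp add: case_prod_beta)
  also have "\<dots> = (\<Sum>x\<in>UNIV. pmf p x * kl_pmf b (W x) ?q)"
    unfolding kl_pmf_def sum_distrib_left pmf_joint by (intro sum.cong refl) auto
  finally show ?thesis .
qed

lemma entropy_pmf_eq_sum:
  fixes p :: "('x::finite) pmf"
  assumes "1 < b"
  shows "entropy_pmf b p = - (\<Sum>x\<in>UNIV. pmf p x * log b (pmf p x))"
proof -
  interpret information_space "measure_pmf p" b
    using assms by unfold_locales
  have "distributed (measure_pmf p) (count_space UNIV) (\<lambda>x. x) (\<lambda>x. ennreal (pmf p x))"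
    using map_pmf_rep_eq[of id p] measure_pmf_eq_density[of p] by (simp add: distributed_def id_def)
  from entropy_distr[OF this] show ?thesis
    by (simp add: entropy_pmf_def lebesgue_integral_count_space_finite)
qed

text \<open>The tangent plane at \<open>(u', v')\<close> of the jointly convex function \<open>(u, v) \<mapsto> u ln (u / v)\<close>. The
  point \<open>(1, 1)\<close> yields Gibbs' inequality, a convex combination of two points the convexity of
  mutual information in the channel.\<close>

lemma mult_ln_quotient_ge:
  fixes u v u' v' :: real
  assumes "0 \<le> u" "0 \<le> v" "0 \<le> u'" "0 \<le> v'" "v = 0 \<Longrightarrow> u = 0" "u' = 0 \<Longrightarrow> u = 0" "v' = 0 \<Longrightarrow> u' = 0"
  shows "u * ln (u / v) \<ge> u * ln (u' / v') + u - v * (u' / v')"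
proof (cases "u = 0")
  case True
  then show ?thesis using assms by simp
next
  case False
  with assms have pos: "0 < u" "0 < v" "0 < u'" "0 < v'" by force+
  have "ln (u' / v') - ln (u / v) = ln ((u' / v') / (u / v))"
    using pos by (subst ln_div) (auto simp: ln_div)
  also have "\<dots> \<le> (u' / v') / (u / v) - 1"
    using pos by (intro ln_le_minus_one) auto
  finally have "u * (ln (u' / v') - ln (u / v)) \<le> u * ((u' / v') / (u / v) - 1)"
    using pos by (intro mult_left_mono) auto
  also have "\<dots> = v * (u' / v') - u"
    using pos by (simp add: field_simps)
  finally show ?thesis by (simp add: algebra_simps)
qed

lemma kl_pmf_eq_ln: "kl_pmf b u v = (\<Sum>y\<in>UNIV. pmf u y * ln (pmf u y / pmf v y)) / ln b"
  by (simp add: kl_pmf_def log_def sum_divide_distrib)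

lemma kl_pmf_nonneg:
  fixes u v :: "('y::finite) pmf"
  assumes "1 < b" "set_pmf u \<subseteq> set_pmf v"
  shows "0 \<le> kl_pmf b u v"
proof -
  \<comment> \<open>The tangent bound at (1, 1) is \<open>u - v\<close> termwise, and two
    probability laws have equal total mass.\<close>
  have "0 = (\<Sum>y\<in>UNIV. pmf u y - pmf v y)"
    by (simp add: sum_subtractf sum_pmf_UNIV)
  also have "\<dots> \<le> (\<Sum>y\<in>UNIV. pmf u y * ln (pmf u y / pmf v y))"
  proof (rule sum_mono)
    fix y
    show "pmf u y - pmf v y \<le> pmf u y * ln (pmf u y / pmf v y)"
      using mult_ln_quotient_ge[of "pmf u y" "pmf v y" 1 1] assms(2)
      by (force simp: set_pmf_iff)
  qed
  finally show ?thesis using assms(1) by (simp add: kl_pmf_eq_ln)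
qed

lemma kl_pmf_self: "kl_pmf b u u = 0"
proof -
  have "pmf u y * log b (pmf u y / pmf u y) = 0" for y
    by (cases "pmf u y = 0") auto
  then show ?thesis unfolding kl_pmf_def by (intro sum.neutral) blast
qed

text \<open>The log ratio against \<open>r\<close> is the log ratio against the output marginal plus
  that of the marginal to \<open>r\<close>. The second part depends on \<open>y\<close> alone, so
  averaging over inputs turns it into one divergence.\<close>

lemma mutual_info_compensation:
  fixes p :: "('x::finite) pmf" and W :: "'x \<Rightarrow> ('y::finite) pmf"
  assumes b: "1 < b" and r: "set_pmf (bind_pmf p W) \<subseteq> set_pmf r"
  shows "(\<Sum>x\<in>UNIV. pmf p x * kl_pmf b (W x) r) = mutual_info b p W + kl_pmf b (bind_pmf p W) r"
proof -
  let ?q = "bind_pmf p W"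
  have *: "pmf p x * (pmf (W x) y * log b (pmf (W x) y / pmf r y)) =
      pmf p x * (pmf (W x) y * log b (pmf (W x) y / pmf ?q y))
      + (pmf p x * pmf (W x) y) * log b (pmf ?q y / pmf r y)" for x y
  proof (cases "x \<in> set_pmf p \<and> y \<in> set_pmf (W x)")
    case True
    then have "y \<in> set_pmf ?q" by auto
    with r True have "0 < pmf (W x) y" "0 < pmf ?q y" "0 < pmf r y"
      by (auto simp: pmf_positive simp del: set_bind_pmf)
    then show ?thesis using b by (simp add: log_divide algebra_simps)
  next
    case False
    then show ?thesis by (auto simp: set_pmf_iff)
  qed
  have "(\<Sum>x\<in>UNIV. \<Sum>y\<in>UNIV. (pmf p x * pmf (W x) y) * log b (pmf ?q y / pmf r y)) = kl_pmf b ?q r"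
    unfolding kl_pmf_def pmf_bind_finite sum_distrib_right by (rule sum.swap)
  then show ?thesis
    unfolding mutual_info_eq_sum_kl[OF b]
    by (simp add: kl_pmf_def sum_distrib_left * sum.distrib)
qed

lemma mutual_info_nonneg:
  fixes p :: "('x::finite) pmf" and W :: "'x \<Rightarrow> ('y::finite) pmf"
  assumes "1 < b"
  shows "0 \<le> mutual_info b p W"
  unfolding mutual_info_eq_sum_kl[OF assms]
proof (rule sum_nonneg)
  fix x
  show "0 \<le> pmf p x * kl_pmf b (W x) (bind_pmf p W)"
  proof (cases "x \<in> set_pmf p")
    case True
    then show ?thesis using assms by (intro mult_nonneg_nonneg kl_pmf_nonneg) auto
  qed (simp add: set_pmf_iff)
qed

lemma mutual_info_const: "1 < b \<Longrightarrow> mutual_info b p (\<lambda>_. r) = 0"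
  for p :: "('x::finite) pmf" and r :: "('y::finite) pmf"
  by (simp add: mutual_info_eq_sum_kl kl_pmf_self)

subsection \<open>Convexity in the channel\<close>

lemma pmf_mix_channel:
  assumes "0 \<le> t" "t \<le> 1"
  shows "pmf (mix_channel t V W x) y = t * pmf (V x) y + (1 - t) * pmf (W x) y"
  using assms by (simp add: mix_channel_def pmf_bind)

lemma mix_channel_in_test_channels:
  assumes "V \<in> test_channels X Y" "W \<in> test_channels X Y"
  shows "mix_channel t V W \<in> test_channels X Y"
  using assms by (auto simp: test_channels_def mix_channel_def split: if_splits) blast+

lemma pmf_bind_mix_channel:
  fixes p :: "('x::finite) pmf"
  assumes "0 \<le> t" "t \<le> 1"
  shows "pmf (bind_pmf p (mix_channel t V W)) y =
    t * pmf (bind_pmf p V) y + (1 - t) * pmf (bind_pmf p W) y"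
  using assms
  by (simp add: pmf_bind_finite pmf_mix_channel sum_distrib_left sum.distrib[symmetric] algebra_simps)

lemma expected_distortion_mix_channel:
  fixes p :: "('x::finite) pmf" and V W :: "'x \<Rightarrow> ('y::finite) pmf"
  assumes "0 \<le> t" "t \<le> 1"
  shows "expected_distortion d p (mix_channel t V W) =
    t * expected_distortion d p V + (1 - t) * expected_distortion d p W"
proof -
  have "expected_distortion d p (mix_channel t V W) = (\<Sum>x\<in>UNIV. \<Sum>y\<in>UNIV.
     t * (pmf p x * (pmf (V x) y * d x y)) + (1 - t) * (pmf p x * (pmf (W x) y * d x y)))"
    unfolding expected_distortion_eq_sum pmf_mix_channel[OF assms] sum_distrib_left
    by (intro sum.cong refl) (simp add: algebra_simps)
  then show ?thesis
    by (simp add: expected_distortion_eq_sum sum.distrib sum_distrib_left)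
qed

text \<open>Each summand is jointly convex in a channel entry and the corresponding entry of the
  output marginal, and both are affine in the channel.\<close>

lemma mutual_info_mix_channel_le:
  fixes p :: "('x::finite) pmf" and V W :: "'x \<Rightarrow> ('y::finite) pmf"
  assumes b: "1 < b" and t: "0 \<le> t" "t \<le> 1"
  shows "mutual_info b p (mix_channel t V W) \<le> t * mutual_info b p V + (1 - t) * mutual_info b p W"
proof -
  let ?M = "mix_channel t V W"
  define f where "f W x y = pmf (W x) y * ln (pmf (W x) y / pmf (bind_pmf p W) y)"
    for W :: "'x \<Rightarrow> 'y pmf" and x y
  have I: "mutual_info b p W = (\<Sum>x\<in>UNIV. \<Sum>y\<in>UNIV. pmf p x * f W x y) / ln b" for W
    by (simp add: mutual_info_eq_sum_kl[OF b] kl_pmf_eq_ln f_def sum_distrib_left sum_divide_distrib)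
  have joint_convex: "pmf p x * f ?M x y \<le> t * (pmf p x * f V x y) + (1 - t) * (pmf p x * f W x y)" for x y
  proof (cases "x \<in> set_pmf p")
    case False
    then show ?thesis by (simp add: set_pmf_iff)
  next
    case x: True
    define u v where "u = pmf (?M x) y" and "v = pmf (bind_pmf p ?M) y"
    \<comment> \<open>The input \<open>x\<close> has positive mass, so an output that is null for
      the marginal is null in row \<open>x\<close>.\<close>
    have ac: "pmf (Z x) y = 0" if "pmf (bind_pmf p Z) y = 0" for Z :: "'x \<Rightarrow> 'y pmf"
      using that x by (auto simp: pmf_eq_0_set_pmf)
    have u: "u = t * pmf (V x) y + (1 - t) * pmf (W x) y"
      and v: "v = t * pmf (bind_pmf p V) y + (1 - t) * pmf (bind_pmf p W) y"
      by (simp_all add: u_def v_def pmf_mix_channel pmf_bind_mix_channel t)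
    have uv: "v = 0 \<Longrightarrow> u = 0" "0 \<le> u" "0 \<le> v"
      using ac[of ?M] by (auto simp: u_def v_def)
    define g where "g Z = pmf (Z x) y * ln (u / v) + pmf (Z x) y - pmf (bind_pmf p Z) y * (u / v)"
      for Z :: "'x \<Rightarrow> 'y pmf"
    have V: "t * g V \<le> t * f V x y"
    proof (cases "t = 0")
      case False
      with t u have "u = 0 \<Longrightarrow> pmf (V x) y = 0"
        by (auto simp: add_nonneg_eq_0_iff)
      with uv ac[of V] t show ?thesis
        unfolding f_def g_def by (intro mult_left_mono mult_ln_quotient_ge) auto
    qed simp
    have W: "(1 - t) * g W \<le> (1 - t) * f W x y"
    proof (cases "t = 1")
      case False
      with t u have "u = 0 \<Longrightarrow> pmf (W x) y = 0"
        by (auto simp: add_nonneg_eq_0_iff)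
      with uv ac[of W] t show ?thesis
        unfolding f_def g_def by (intro mult_left_mono mult_ln_quotient_ge) auto
    qed simp
    \<comment> \<open>The tangent plane \<open>g\<close> is affine, so averaging its values gives
      its value at the mixture, where it touches the function.\<close>
    have "t * g V + (1 - t) * g W = u * ln (u / v) + u - v * (u / v)"
      unfolding g_def u v by (simp only: algebra_simps)
    also have "\<dots> = f ?M x y"
      using uv by (auto simp: f_def u_def v_def)
    finally have "f ?M x y \<le> t * f V x y + (1 - t) * f W x y"
      using V W by linarith
    then have "pmf p x * f ?M x y \<le> pmf p x * (t * f V x y + (1 - t) * f W x y)"
      by (intro mult_left_mono) auto
    then show ?thesis by (simp add: algebra_simps)
  qed
  have "(\<Sum>x\<in>UNIV. \<Sum>y\<in>UNIV. pmf p x * f ?M x y) \<le>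
     t * (\<Sum>x\<in>UNIV. \<Sum>y\<in>UNIV. pmf p x * f V x y) + (1 - t) * (\<Sum>x\<in>UNIV. \<Sum>y\<in>UNIV. pmf p x * f W x y)"
    unfolding sum_distrib_left sum.distrib[symmetric] by (intro sum_mono joint_convex)
  then have "(\<Sum>x\<in>UNIV. \<Sum>y\<in>UNIV. pmf p x * f ?M x y) / ln b \<le>
     (t * (\<Sum>x\<in>UNIV. \<Sum>y\<in>UNIV. pmf p x * f V x y) + (1 - t) * (\<Sum>x\<in>UNIV. \<Sum>y\<in>UNIV. pmf p x * f W x y)) / ln b"
    using b by (intro divide_right_mono) auto
  then show ?thesis unfolding I by (simp add: add_divide_distrib)
qed

subsection \<open>Attainment of the minimum\<close>

lemma continuous_on_mult_ln: "continuous_on {0..} (\<lambda>x::real. x * ln x)"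
proof -
  have "continuous (at x within {0..}) (\<lambda>x::real. x * ln x)" if "0 \<le> x" for x
  proof (cases "x = 0")
    case True
    have "((\<lambda>x::real. x * ln x) \<longlongrightarrow> 0) (at_right 0)" by real_asymp
    then have "((\<lambda>x::real. x * ln x) \<longlongrightarrow> 0) (at 0 within {0..})"
      by (simp add: at_within_Ici_at_right)
    with True show ?thesis by (simp add: continuous_within)
  next
    case False
    then show ?thesis using that by (intro continuous_intros) auto
  qed
  then show ?thesis by (simp add: continuous_on_eq_continuous_within)
qed

text \<open>This form serves continuity: the quotients in the divergence are delicate where the
  marginal vanishes, whereas here only \<open>x * ln x\<close> occurs, which is continuous up to
  0.\<close>

lemma mutual_info_eq_entropy_difference:
  fixes p :: "('x::finite) pmf" and W :: "'x \<Rightarrow> ('y::finite) pmf"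
  assumes b: "1 < b"
  shows "mutual_info b p W =
    ((\<Sum>x\<in>UNIV. pmf p x * (\<Sum>y\<in>UNIV. pmf (W x) y * ln (pmf (W x) y)))
      - (\<Sum>y\<in>UNIV. pmf (bind_pmf p W) y * ln (pmf (bind_pmf p W) y))) / ln b"
proof -
  let ?q = "bind_pmf p W"
  have *: "pmf p x * (pmf (W x) y * ln (pmf (W x) y / pmf ?q y)) =
      pmf p x * (pmf (W x) y * ln (pmf (W x) y)) - pmf p x * pmf (W x) y * ln (pmf ?q y)" for x y
  proof (cases "x \<in> set_pmf p \<and> y \<in> set_pmf (W x)")
    case True
    then have "y \<in> set_pmf ?q" by auto
    with True have "0 < pmf (W x) y" "0 < pmf ?q y" 
      by (auto simp: pmf_positive simp del: set_bind_pmf)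
    then show ?thesis by (simp add: ln_div algebra_simps)
  next
    case False
    then show ?thesis by (auto simp: set_pmf_iff)
  qed
  have "(\<Sum>x\<in>UNIV. \<Sum>y\<in>UNIV. pmf p x * pmf (W x) y * ln (pmf ?q y)) = (\<Sum>y\<in>UNIV. pmf ?q y * ln (pmf ?q y))"
    unfolding sum_distrib_right[symmetric] by (subst sum.swap) (simp add: pmf_bind_finite sum_distrib_right)
  then show ?thesis
    unfolding mutual_info_eq_sum_kl[OF b] kl_pmf_eq_ln
    by (simp add: sum_divide_distrib[symmetric] sum_distrib_left * sum_subtractf)
qed

text \<open>Channels are encoded as matrices, where \<open>K\<close> is the feasible polytope and
  \<open>I\<close> the objective; a continuous function attains its infimum on a nonempty compact
  set.\<close>

lemma rate_distortion_attained:
  fixes p :: "('x::finite) pmf" and d :: "'x \<Rightarrow> 'y::finite \<Rightarrow> real"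
  assumes b: "1 < b" and feas: "feasible_channels d p X Y D \<noteq> {}"
  shows "\<exists>W\<in>feasible_channels d p X Y D. rate_distortion b d p X Y D = ereal (mutual_info b p W)"
proof -
  let ?F = "feasible_channels d p X Y D"
  define mat :: "('x \<Rightarrow> 'y pmf) \<Rightarrow> real^'y^'x" where "mat W = (\<chi> x y. pmf (W x) y)" for W
  \<comment> \<open>All rows are stochastic, also those outside \<open>X\<close>: this bounds
    \<open>K\<close> and lets every point of it come from a channel.\<close>
  define K :: "(real^'y^'x) set" where "K =
    {M. (\<forall>x y. 0 \<le> M $ x $ y) \<and> (\<forall>x. (\<Sum>y\<in>UNIV. M $ x $ y) = 1) \<and> (\<forall>x\<in>X. \<forall>y\<in>-Y. M $ x $ y = 0) \<and>
        (\<Sum>x\<in>UNIV. pmf p x * (\<Sum>y\<in>UNIV. M $ x $ y * d x y)) \<le> D}"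
  define I :: "real^'y^'x \<Rightarrow> real" where "I M =
    ((\<Sum>x\<in>UNIV. pmf p x * (\<Sum>y\<in>UNIV. M $ x $ y * ln (M $ x $ y)))
      - (\<Sum>y\<in>UNIV. (\<Sum>x\<in>UNIV. pmf p x * M $ x $ y) * ln (\<Sum>x\<in>UNIV. pmf p x * M $ x $ y))) / ln b" for M
  have I_mat: "I (mat W) = mutual_info b p W" for W
    by (simp add: I_def mat_def mutual_info_eq_entropy_difference[OF b] pmf_bind_finite)
  have mat_K: "mat W \<in> K" if "W \<in> ?F" for W
    using that
    by (auto simp: K_def mat_def feasible_channels_def test_channels_def sum_pmf_UNIV
        expected_distortion_eq_sum pmf_eq_0_set_pmf)
  have K_mat: "\<exists>W\<in>?F. M = mat W" if "M \<in> K" for M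
  proof -
    define W where "W x = embed_pmf (\<lambda>y. M $ x $ y)" for x
    have W: "pmf (W x) y = M $ x $ y" for x y
      unfolding W_def using that
      by (intro pmf_embed_pmf) (auto simp: K_def nn_integral_count_space_finite sum_ennreal)
    have "y \<in> Y" if "x \<in> X" "y \<in> set_pmf (W x)" for x y
    proof (rule ccontr)
      assume "y \<notin> Y"
      with \<open>M \<in> K\<close> that(1) have "M $ x $ y = 0" by (simp add: K_def)
      with that(2) show False by (simp add: set_pmf_iff W)
    qed
    then have "W \<in> test_channels X Y"
      by (auto simp: test_channels_def)
    moreover have "expected_distortion d p W \<le> D"
      using that by (simp add: expected_distortion_eq_sum W K_def)
    ultimately have "W \<in> ?F"
      by (simp add: feasible_channels_def)
    moreover have "M = mat W" by (simp add: mat_def W vec_eq_iff)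
    ultimately show ?thesis by blast
  qed
  have "closed K"
    unfolding K_def Ball_def
    by (intro closed_Collect_conj closed_Collect_all closed_Collect_imp closed_Collect_le closed_Collect_eq
        continuous_intros open_Collect_const)
  moreover have "bounded K"
  proof (rule boundedI)
    fix M assume M: "M \<in> K"
    \<comment> \<open>Each row is a probability vector, of l1 norm 1, so the norm is at most the
      number of rows.\<close>
    have "norm M \<le> (\<Sum>x\<in>UNIV. norm (M $ x))" by (simp add: norm_vec_def L2_set_le_sum)
    also have "\<dots> \<le> (\<Sum>x\<in>(UNIV::'x set). 1)"
    proof (rule sum_mono)
      fix x
      have "norm (M $ x) \<le> (\<Sum>y\<in>UNIV. \<bar>M $ x $ y\<bar>)" by (rule norm_le_l1_cart)
      with M show "norm (M $ x) \<le> 1" by (simp add: K_def)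
    qed
    finally show "norm M \<le> (\<Sum>x\<in>(UNIV::'x set). 1)" .
  qed
  ultimately have compact: "compact K" by (simp add: compact_eq_bounded_closed)
  have nonempty: "K \<noteq> {}" using feas mat_K by blast
  \<comment> \<open>Entries and output marginals are nonnegative on \<open>K\<close>, which keeps
    the arguments of \<open>x * ln x\<close> in its domain of continuity.\<close>
  have continuous: "continuous_on K I"
    unfolding I_def
    by (intro continuous_intros continuous_on_compose2[OF continuous_on_mult_ln])
       (use b in \<open>auto simp: K_def intro!: sum_nonneg\<close>)
  obtain M where M: "M \<in> K" "\<And>M'. M' \<in> K \<Longrightarrow> I M \<le> I M'"
    using continuous_attains_inf[OF compact nonempty continuous] by blast
  then obtain W where W: "W \<in> ?F" "M = mat W" using K_mat by blast
  have "rate_distortion b d p X Y D = ereal (mutual_info b p W)"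
    unfolding rate_distortion_def
  proof (rule antisym)
    show "(INF W\<in>?F. ereal (mutual_info b p W)) \<le> ereal (mutual_info b p W)"
      using W by (intro INF_lower)
    show "ereal (mutual_info b p W) \<le> (INF W\<in>?F. ereal (mutual_info b p W))"
    proof (rule INF_greatest)
      fix V assume "V \<in> ?F"
      from M(2)[OF mat_K[OF this]] show "ereal (mutual_info b p W) \<le> ereal (mutual_info b p V)"
        by (simp add: W(2) I_mat)
    qed
  qed
  with W show ?thesis by blast
qed

section \<open>Monotonicity and convexity in the distortion budget\<close>

lemma rate_distortion_empty:
  "feasible_channels d p X Y D = {} \<Longrightarrow> rate_distortion b d p X Y D = \<infinity>"
  by (simp add: rate_distortion_def top_ereal_def)

lemma rate_distortion_le:
  "W \<in> feasible_channels d p X Y D \<Longrightarrow> rate_distortion b d p X Y D \<le> ereal (mutual_info b p W)"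
  unfolding rate_distortion_def by (rule INF_lower)

lemma rate_distortion_antimono:
  "D \<le> D' \<Longrightarrow> rate_distortion b d p X Y D' \<le> rate_distortion b d p X Y D"
  unfolding rate_distortion_def by (intro INF_superset_mono) (auto simp: feasible_channels_def)

lemma rate_distortion_convex:
  fixes p :: "('x::finite) pmf" and d :: "'x \<Rightarrow> 'y::finite \<Rightarrow> real"
  assumes b: "1 < b" and t: "0 \<le> t" "t \<le> 1"
  shows "rate_distortion b d p X Y (t * D1 + (1 - t) * D2) \<le>
    ereal t * rate_distortion b d p X Y D1 + ereal (1 - t) * rate_distortion b d p X Y D2"
proof -
  \<comment> \<open>In \<open>ereal\<close>, \<open>0 * \<infinity> = 0\<close>, so one infeasible
    budget makes the right-hand side infinite only when both weights are positive.\<close>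
  consider "t = 0" | "t = 1" | "0 < t" "t < 1" using t by linarith
  then show ?thesis
  proof cases
    case 3
    show ?thesis
    proof (cases "feasible_channels d p X Y D1 = {} \<or> feasible_channels d p X Y D2 = {}")
      case True
      then show ?thesis using 3 by (auto simp: rate_distortion_empty)
    next
      case False
      then obtain V W where V: "V \<in> feasible_channels d p X Y D1"
          "rate_distortion b d p X Y D1 = ereal (mutual_info b p V)"
        and W: "W \<in> feasible_channels d p X Y D2"
          "rate_distortion b d p X Y D2 = ereal (mutual_info b p W)"
        using rate_distortion_attained[OF b] by meson
      have "mix_channel t V W \<in> feasible_channels d p X Y (t * D1 + (1 - t) * D2)"
        using V(1) W(1) t
        by (auto simp: feasible_channels_def expected_distortion_mix_channel
            intro!: mix_channel_in_test_channels add_mono mult_left_mono)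
      then have "rate_distortion b d p X Y (t * D1 + (1 - t) * D2)
          \<le> ereal (mutual_info b p (mix_channel t V W))"
        by (rule rate_distortion_le)
      also have "\<dots> \<le> ereal (t * mutual_info b p V + (1 - t) * mutual_info b p W)"
        using mutual_info_mix_channel_le[OF b t] by simp
      finally show ?thesis by (simp add: V W)
    qed
  qed (simp_all flip: zero_ereal_def)
qed

section \<open>Disjoint outputs, entropy and zero distortion\<close>

lemma joint_pmf_cong:
  "(\<And>x. x \<in> set_pmf p \<Longrightarrow> V x = W x) \<Longrightarrow> joint_pmf p V = joint_pmf p W"
  unfolding joint_pmf_def by (intro bind_pmf_cong) auto

text \<open>Disjoint output supports let the input be recovered from the output, so no conditional
  entropy remains.\<close>

lemma mutual_info_eq_entropy:
  fixes p :: "('x::finite) pmf" and W :: "'x \<Rightarrow> ('y::finite) pmf"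
  assumes b: "1 < b"
    and disj: "\<And>x x'. x \<in> set_pmf p \<Longrightarrow> x' \<in> set_pmf p \<Longrightarrow> x \<noteq> x' \<Longrightarrow> set_pmf (W x) \<inter> set_pmf (W x') = {}"
  shows "mutual_info b p W = entropy_pmf b p"
proof -
  let ?q = "bind_pmf p W"
  have "pmf p x * kl_pmf b (W x) ?q = - (pmf p x * log b (pmf p x))" for x
  proof (cases "x \<in> set_pmf p")
    case False
    then show ?thesis by (simp add: set_pmf_iff)
  next
    case x: True
    have "pmf (W x) y * log b (pmf (W x) y / pmf ?q y) = pmf (W x) y * (- log b (pmf p x))" for y
    proof (cases "y \<in> set_pmf (W x)")
      case y: True
      \<comment> \<open>Only \<open>x\<close> can produce \<open>y\<close>, so the marginal at
        \<open>y\<close> has a single term and the log ratio becomes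
        \<open>- log b (pmf p x)\<close>, independent of \<open>y\<close>.\<close>
      have "pmf p x' * pmf (W x') y = (if x' = x then pmf p x * pmf (W x) y else 0)" for x'
      proof (cases "x' = x \<or> x' \<notin> set_pmf p")
        case False
        then have "y \<notin> set_pmf (W x')" using disj[OF x, of x'] y by blast
        with False show ?thesis by (simp add: set_pmf_iff)
      qed (auto simp: set_pmf_iff)
      then have "pmf ?q y = (\<Sum>x'\<in>UNIV. if x' = x then pmf p x * pmf (W x) y else 0)"
        unfolding pmf_bind_finite by (rule sum.cong[OF refl])
      then have "pmf ?q y = pmf p x * pmf (W x) y" by simp
      moreover have "0 < pmf p x" "0 < pmf (W x) y"
        using x y by (auto simp: pmf_positive)
      ultimately show ?thesis
        using b by (simp add: log_divide log_mult)
    qed (simp add: set_pmf_iff)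
    then have "kl_pmf b (W x) ?q = - log b (pmf p x)"
      unfolding kl_pmf_def by (simp add: sum_negf sum_distrib_right[symmetric] sum_pmf_UNIV)
    then show ?thesis by simp
  qed
  then show ?thesis
    by (simp add: mutual_info_eq_sum_kl[OF b] entropy_pmf_eq_sum[OF b] sum_negf)
qed

lemma expected_distortion_nonpos_imp_zero:
  fixes p :: "('x::finite) pmf" and W :: "'x \<Rightarrow> ('y::finite) pmf"
  assumes "\<And>x y. 0 \<le> d x y" and "expected_distortion d p W \<le> 0"
    and "x \<in> set_pmf p" "y \<in> set_pmf (W x)"
  shows "d x y = 0"
proof -
  have nn: "0 \<le> pmf p x * (\<Sum>y\<in>UNIV. pmf (W x) y * d x y)" for x
    using assms(1) by (intro mult_nonneg_nonneg sum_nonneg) auto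
  then have "(\<Sum>x\<in>UNIV. pmf p x * (\<Sum>y\<in>UNIV. pmf (W x) y * d x y)) = 0"
    using assms(2) unfolding expected_distortion_eq_sum by (intro antisym sum_nonneg)
  then have "pmf p x * (\<Sum>y\<in>UNIV. pmf (W x) y * d x y) = 0"
    using nn by (subst (asm) sum_nonneg_eq_0_iff) auto
  then have "(\<Sum>y\<in>UNIV. pmf (W x) y * d x y) = 0"
    using assms(3) by (simp add: set_pmf_iff)
  then have "pmf (W x) y * d x y = 0"
    using assms(1) by (subst (asm) sum_nonneg_eq_0_iff) auto
  then show ?thesis
    using assms(4) by (simp add: set_pmf_iff)
qed

subsection \<open>Restriction of the source to a subset\<close>

text \<open>Total expectation with the complement left unnormalised, so that a set \<open>A\<close>
  of full mass is covered too.\<close>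

lemma sum_pmf_split_cond:
  fixes p :: "('x::finite) pmf"
  assumes "measure_pmf.prob p A \<noteq> 0"
  shows "(\<Sum>x\<in>UNIV. pmf p x * f x) =
    measure_pmf.prob p A * (\<Sum>x\<in>UNIV. pmf (cond_pmf p A) x * f x) + (\<Sum>x\<in>-A. pmf p x * f x)"
proof -
  have ne: "set_pmf p \<inter> A \<noteq> {}"
    using assms by (simp add: measure_pmf_zero_iff)
  have "measure_pmf.prob p A * (\<Sum>x\<in>UNIV. pmf (cond_pmf p A) x * f x)
      = (\<Sum>x\<in>UNIV. if x \<in> A then pmf p x * f x else 0)"
    unfolding sum_distrib_left using assms by (intro sum.cong refl) (simp add: pmf_cond[OF ne])
  also have "\<dots> = (\<Sum>x\<in>A. pmf p x * f x)"
    by (simp add: sum.If_cases)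
  finally show ?thesis
    using sum.union_disjoint[of A "-A" "\<lambda>x. pmf p x * f x"] by (simp add: Compl_partition)
qed

lemma expected_distortion_eq_0:
  fixes p :: "('x::finite) pmf" and W :: "'x \<Rightarrow> ('y::finite) pmf"
  assumes "\<And>x y. x \<in> set_pmf p \<Longrightarrow> y \<in> set_pmf (W x) \<Longrightarrow> d x y = 0"
  shows "expected_distortion d p W = 0"
  unfolding expected_distortion_eq_sum sum_distrib_left
  using assms by (intro sum.neutral ballI) (auto simp: set_pmf_iff)

lemma expected_distortion_cond_pmf:
  fixes p :: "('x::finite) pmf" and W :: "'x \<Rightarrow> ('y::finite) pmf"
  assumes "measure_pmf.prob p A \<noteq> 0"
    and "\<And>x y. x \<in> set_pmf p - A \<Longrightarrow> y \<in> set_pmf (W x) \<Longrightarrow> d x y = 0"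
  shows "expected_distortion d p W = measure_pmf.prob p A * expected_distortion d (cond_pmf p A) W"
proof -
  have "(\<Sum>x\<in>-A. pmf p x * (\<Sum>y\<in>UNIV. pmf (W x) y * d x y)) = 0"
    unfolding sum_distrib_left
    using assms(2) by (intro sum.neutral ballI) (auto simp: set_pmf_iff)
  then show ?thesis
    unfolding expected_distortion_eq_sum by (subst sum_pmf_split_cond[OF assms(1)]) simp
qed

text \<open>Dropping the inputs outside \<open>A\<close> discards nonnegative divergences. Those
  kept are measured from the full marginal, which by compensation cannot beat the marginal that
  \<open>A\<close> induces itself.\<close>

lemma mutual_info_cond_pmf_le:
  fixes p :: "('x::finite) pmf" and W :: "'x \<Rightarrow> ('y::finite) pmf"
  assumes b: "1 < b" and A: "measure_pmf.prob p A \<noteq> 0"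
  shows "measure_pmf.prob p A * mutual_info b (cond_pmf p A) W \<le> mutual_info b p W"
proof -
  let ?q = "bind_pmf p W" and ?c = "cond_pmf p A"
  have "set_pmf ?c \<subseteq> set_pmf p"
    using A by (simp add: set_cond_pmf measure_pmf_zero_iff)
  then have ac: "set_pmf (bind_pmf ?c W) \<subseteq> set_pmf ?q" by auto
  have "0 \<le> (\<Sum>x\<in>-A. pmf p x * kl_pmf b (W x) ?q)"
  proof (rule sum_nonneg)
    fix x
    show "0 \<le> pmf p x * kl_pmf b (W x) ?q"
    proof (cases "x \<in> set_pmf p")
      case True
      then show ?thesis using b by (intro mult_nonneg_nonneg kl_pmf_nonneg) auto
    qed (simp add: set_pmf_iff)
  qed
  moreover have "mutual_info b ?c W \<le> (\<Sum>x\<in>UNIV. pmf ?c x * kl_pmf b (W x) ?q)"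
    unfolding mutual_info_compensation[OF b ac] using kl_pmf_nonneg[OF b ac] by simp
  then have "measure_pmf.prob p A * mutual_info b ?c W \<le>
      measure_pmf.prob p A * (\<Sum>x\<in>UNIV. pmf ?c x * kl_pmf b (W x) ?q)"
    by (intro mult_left_mono) auto
  ultimately show ?thesis
    unfolding mutual_info_eq_sum_kl[OF b, of p] sum_pmf_split_cond[OF A] by linarith
qed

text \<open>Outside \<open>A\<close> the output is drawn from the output marginal induced on \<open>A\<close>, independently of
  the input, so those inputs cost no rate and leave the marginal unchanged.\<close>

definition extend_channel :: "'x pmf \<Rightarrow> 'x set \<Rightarrow> ('x \<Rightarrow> 'y pmf) \<Rightarrow> 'x \<Rightarrow> 'y pmf" where
  "extend_channel p A W x = (if x \<in> A then W x else bind_pmf (cond_pmf p A) W)"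

lemma extend_channel_in_test_channels:
  assumes "measure_pmf.prob p A \<noteq> 0" "W \<in> test_channels A Y"
  shows "extend_channel p A W \<in> test_channels X Y"
proof -
  have "set_pmf (cond_pmf p A) \<subseteq> A"
    using assms(1) by (simp add: set_cond_pmf measure_pmf_zero_iff)
  with assms(2) show ?thesis
    unfolding test_channels_def extend_channel_def by auto
qed

lemma joint_pmf_cond_extend_channel:
  assumes "measure_pmf.prob p A \<noteq> 0"
  shows "joint_pmf (cond_pmf p A) (extend_channel p A W) = joint_pmf (cond_pmf p A) W"
  using assms by (intro joint_pmf_cong) (simp add: extend_channel_def set_cond_pmf measure_pmf_zero_iff)

lemma mutual_info_extend_channel:
  fixes p :: "('x::finite) pmf" and W :: "'x \<Rightarrow> ('y::finite) pmf"
  assumes b: "1 < b" and A: "measure_pmf.prob p A \<noteq> 0"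
  shows "mutual_info b p (extend_channel p A W) = measure_pmf.prob p A * mutual_info b (cond_pmf p A) W"
proof -
  let ?V = "extend_channel p A W" and ?c = "cond_pmf p A"
  have out: "bind_pmf ?c ?V = bind_pmf ?c W"
    using joint_pmf_cond_extend_channel[OF A, of W] map_snd_joint_pmf by metis
  have compl: "(\<Sum>x\<in>-A. pmf p x) = 1 - measure_pmf.prob p A"
    using measure_pmf.prob_compl[of A p] by (simp add: measure_measure_pmf_finite Compl_eq_Diff_UNIV)
  \<comment> \<open>The set \<open>A\<close> and its complement contribute the same output law, with
    weights that add up to 1.\<close>
  have q: "bind_pmf p ?V = bind_pmf ?c W"
  proof (rule pmf_eqI)
    fix y
    have "(\<Sum>x\<in>-A. pmf p x * pmf (?V x) y) = (\<Sum>x\<in>-A. pmf p x) * pmf (bind_pmf ?c W) y"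
      unfolding sum_distrib_right by (intro sum.cong) (auto simp: extend_channel_def)
    moreover have "(\<Sum>x\<in>UNIV. pmf ?c x * pmf (?V x) y) = pmf (bind_pmf ?c W) y"
      by (simp add: out flip: pmf_bind_finite)
    ultimately show "pmf (bind_pmf p ?V) y = pmf (bind_pmf ?c W) y"
      unfolding pmf_bind_finite[of p] sum_pmf_split_cond[OF A] compl by (simp add: algebra_simps)
  qed
  have "(\<Sum>x\<in>-A. pmf p x * kl_pmf b (?V x) (bind_pmf ?c W)) = 0"
    by (intro sum.neutral) (simp add: extend_channel_def kl_pmf_self)
  moreover have "(\<Sum>x\<in>UNIV. pmf ?c x * kl_pmf b (?V x) (bind_pmf ?c W)) = mutual_info b ?c W"
    using mutual_info_eq_sum_kl[OF b, of ?c ?V]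
    by (simp add: out mutual_info_def joint_pmf_cond_extend_channel[OF A])
  ultimately show ?thesis
    unfolding mutual_info_eq_sum_kl[OF b, of p] q sum_pmf_split_cond[OF A] by simp
qed

text \<open>Inputs outside \<open>A\<close> have no distortion, so the expected distortion is the
  conditional one scaled by the mass of \<open>A\<close>; this is the origin of the budget
  \<open>D / measure_pmf.prob p A\<close>. Extending channels from \<open>A\<close> gives one
  inequality, restricting them to \<open>A\<close> the other.\<close>

theorem rate_distortion_cond_pmf:
  fixes p :: "('x::finite) pmf" and d :: "'x \<Rightarrow> 'y::finite \<Rightarrow> real"
  assumes b: "1 < b" and A: "measure_pmf.prob p A \<noteq> 0" "A \<subseteq> X" and p: "set_pmf p \<subseteq> X"
    and d: "\<And>x y. x \<in> X - A \<Longrightarrow> y \<in> Y \<Longrightarrow> d x y = 0"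
  shows "rate_distortion b d p X Y D =
    ereal (measure_pmf.prob p A) * rate_distortion b d (cond_pmf p A) A Y (D / measure_pmf.prob p A)"
    (is "_ = ereal ?a * ?R")
proof (rule antisym)
  have a: "0 < ?a" using A(1) by (simp add: zero_less_measure_iff)
  have dist: "expected_distortion d p W = ?a * expected_distortion d (cond_pmf p A) W"
    if "W \<in> test_channels X Y" for W
  proof (rule expected_distortion_cond_pmf[OF A(1)])
    fix x y assume "x \<in> set_pmf p - A" "y \<in> set_pmf (W x)"
    moreover from this have "x \<in> X" using p by blast
    ultimately show "d x y = 0" using that by (intro d) (auto simp: test_channels_def)
  qed
  show "rate_distortion b d p X Y D \<le> ereal ?a * ?R"
  proof (cases "feasible_channels d (cond_pmf p A) A Y (D / ?a) = {}")
    case True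
    then show ?thesis using a by (simp add: rate_distortion_empty)
  next
    case False
    then obtain W where W: "W \<in> feasible_channels d (cond_pmf p A) A Y (D / ?a)"
      "?R = ereal (mutual_info b (cond_pmf p A) W)"
      using rate_distortion_attained[OF b] by blast
    let ?V = "extend_channel p A W"
    have V: "?V \<in> test_channels X Y"
      using W(1) by (intro extend_channel_in_test_channels A) (simp add: feasible_channels_def)
    have "expected_distortion d (cond_pmf p A) ?V \<le> D / ?a"
      using W(1) by (simp add: feasible_channels_def expected_distortion_def joint_pmf_cond_extend_channel[OF A(1)])
    then have "?V \<in> feasible_channels d p X Y D"
      using V a by (simp add: feasible_channels_def dist field_simps)
    then show ?thesis
      using rate_distortion_le[of ?V d p X Y D b] by (simp add: W mutual_info_extend_channel[OF b A(1)])
  qed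
  show "ereal ?a * ?R \<le> rate_distortion b d p X Y D"
    unfolding rate_distortion_def[of b d p]
  proof (rule INF_greatest)
    fix W assume W: "W \<in> feasible_channels d p X Y D"
    \<comment> \<open>The restriction is the same kernel \<open>W\<close>, since a test channel is
      constrained only on its input set.\<close>
    then have "W \<in> feasible_channels d (cond_pmf p A) A Y (D / ?a)"
      using A(2) a by (auto simp: feasible_channels_def test_channels_def dist field_simps)
    then have "ereal ?a * ?R \<le> ereal ?a * ereal (mutual_info b (cond_pmf p A) W)"
      by (intro ereal_mult_left_mono rate_distortion_le) auto
    also have "\<dots> \<le> ereal (mutual_info b p W)"
      using mutual_info_cond_pmf_le[OF b A(1)] by simp
    finally show "ereal ?a * ?R \<le> ereal (mutual_info b p W)" .
  qed
qed

text \<open>One reconstruction serves every input, and a constant channel carries no information.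
  This settles a core of mass 0.\<close>

lemma rate_distortion_eq_0:
  fixes p :: "('x::finite) pmf" and d :: "'x \<Rightarrow> 'y::finite \<Rightarrow> real"
  assumes b: "1 < b" and "0 \<le> D" "y \<in> Y" and d: "\<And>x. x \<in> set_pmf p \<Longrightarrow> d x y = 0"
  shows "rate_distortion b d p X Y D = 0"
proof (rule antisym)
  have "(\<lambda>_. return_pmf y) \<in> feasible_channels d p X Y D"
    using assms expected_distortion_eq_0[of p "\<lambda>_. return_pmf y" d]
    by (simp add: feasible_channels_def test_channels_def)
  from rate_distortion_le[OF this, of b] show "rate_distortion b d p X Y D \<le> 0"
    by (simp add: mutual_info_const[OF b] zero_ereal_def)
  show "0 \<le> rate_distortion b d p X Y D"
    unfolding rate_distortion_def by (intro INF_greatest) (simp add: mutual_info_nonneg[OF b])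
qed

text \<open>At budget 0 a channel uses only reconstructions of distortion 0, and distinct inputs
  share none. Every feasible channel therefore has the entropy as its information; the identity
  channel shows that one exists.\<close>

lemma rate_distortion_zero_eq_entropy:
  fixes p :: "('x::finite) pmf" and d :: "'x \<Rightarrow> 'x \<Rightarrow> real"
  assumes b: "1 < b" and d: "\<And>x y. 0 \<le> d x y" "\<And>x. d x x = 0" and p: "set_pmf p \<subseteq> X" and "X \<subseteq> Y"
    and disj: "\<And>x x' y. x \<in> X \<Longrightarrow> x' \<in> X \<Longrightarrow> y \<in> Y \<Longrightarrow> d x y = 0 \<Longrightarrow> d x' y = 0 \<Longrightarrow> x = x'"
  shows "rate_distortion b d p X Y 0 = ereal (entropy_pmf b p)"
proof -
  have "return_pmf \<in> feasible_channels d p X Y 0"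
    using assms expected_distortion_eq_0[of p return_pmf d]
    by (auto simp: feasible_channels_def test_channels_def)
  then obtain W where W: "W \<in> feasible_channels d p X Y 0"
    "rate_distortion b d p X Y 0 = ereal (mutual_info b p W)"
    using rate_distortion_attained[OF b] by blast
  have zero: "y \<in> Y \<and> d x y = 0" if "x \<in> set_pmf p" "y \<in> set_pmf (W x)" for x y
    using W(1) that p expected_distortion_nonpos_imp_zero[of d p W x y] d(1)
    by (auto simp: feasible_channels_def test_channels_def)
  have "set_pmf (W x) \<inter> set_pmf (W x') = {}" if "x \<in> set_pmf p" "x' \<in> set_pmf p" "x \<noteq> x'" for x x'
    using zero[OF that(1)] zero[OF that(2)] disj p that by blast
  then show ?thesis
    using W(2) mutual_info_eq_entropy[OF b] by metis
qed

subsection \<open>The irredundant core\<close>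

lemma fold_deletion_step_subset: "fold (deletion_step Cn) xs B \<subseteq> B"
proof (induction xs arbitrary: B)
  case (Cons x xs)
  have "deletion_step Cn x B \<subseteq> B" by (auto simp: deletion_step_def)
  with Cons[of "deletion_step Cn x B"] show ?case by simp
qed simp

text \<open>The set current when \<open>s\<close> is removed lies inside \<open>B\<close>, so
  monotonicity carries the derivation of \<open>s\<close> back to \<open>B - {s}\<close>.\<close>

lemma deleted_imp_derivable:
  assumes Cn: "consequence_operator Cn" and "s \<in> B" "s \<notin> fold (deletion_step Cn) xs B"
  shows "s \<in> Cn (B - {s})"
  using assms(2,3)
proof (induction xs arbitrary: B)
  case (Cons x xs)
  let ?B = "deletion_step Cn x B"
  show ?case
  proof (cases "s \<in> ?B")
    case True
    then have "s \<in> Cn (?B - {s})" using Cons by simp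
    moreover have "?B - {s} \<subseteq> B - {s}" by (auto simp: deletion_step_def)
    ultimately show ?thesis using Cn unfolding consequence_operator_def by blast
  next
    case False
    \<comment> \<open>A step can remove only the scanned element, so \<open>s = x\<close> and the
      deletion test is the claim itself.\<close>
    then show ?thesis using Cons.prems by (auto simp: deletion_step_def split: if_splits)
  qed
qed simp

lemma Atom_subset: "Atom Cn S \<subseteq> set S"
  unfolding Atom_def by (rule fold_deletion_step_subset)

lemma d_Cn_nonneg: "0 \<le> d_Cn Cn K s t" for Cn :: "('s::finite) set \<Rightarrow> 's set"
proof -
  have "card (X \<inter> Y) \<le> card (X \<union> Y)" for X Y :: "'s set"
    by (intro card_mono) auto
  then show ?thesis
    by (auto simp: d_Cn_def Let_def divide_le_eq)
qed

lemma d_Cn_eq_0_if_closure_eq: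
  fixes Cn :: "('s::finite) set \<Rightarrow> 's set"
  assumes "replaced_closure Cn K s t = replaced_closure Cn K s s"
  shows "d_Cn Cn K s t = 0"
  by (simp add: d_Cn_def assms Let_def)

lemma d_Cn_redundant:
  fixes Cn :: "('s::finite) set \<Rightarrow> 's set"
  assumes Cn: "consequence_operator Cn" and s: "s \<in> K" "s \<in> Cn (K - {s})" and t: "t \<in> Cn K"
  shows "d_Cn Cn K s t = 0"
proof (rule d_Cn_eq_0_if_closure_eq)
  have ext: "X \<subseteq> Cn X" and mono: "X \<subseteq> Y \<Longrightarrow> Cn X \<subseteq> Cn Y" and idem: "Cn (Cn X) = Cn X" for X Y
    using Cn by (auto simp: consequence_operator_def)
  have "K \<subseteq> Cn (K - {s})" using ext[of "K - {s}"] s(2) by auto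
  \<comment> \<open>Apply \<open>Cn\<close> to both sides and collapse the double closure by
    idempotence.\<close>
  then have "Cn K \<subseteq> Cn (K - {s})" using mono idem by metis
  also have "\<dots> \<subseteq> Cn (K - {s} \<union> {t})" by (rule mono) auto
  finally have "Cn K \<subseteq> Cn (K - {s} \<union> {t})" .
  moreover have "K - {s} \<union> {t} \<subseteq> Cn K" using ext[of K] t by auto
  then have "Cn (K - {s} \<union> {t}) \<subseteq> Cn K" using mono idem by metis
  moreover have "K - {s} \<union> {s} = K" using s(1) by auto
  ultimately show "replaced_closure Cn K s t = replaced_closure Cn K s s"
    unfolding replaced_closure_def by simp
qed

lemma d_Cn_redundant_part:
  fixes Cn :: "('s::finite) set \<Rightarrow> 's set"
  assumes "consequence_operator Cn" "s \<in> redundant_part Cn S" "t \<in> Cn (set S)"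
  shows "d_Cn Cn (set S) s t = 0"
  using assms deleted_imp_derivable[OF assms(1), of s "set S" S]
  by (intro d_Cn_redundant) (auto simp: redundant_part_def Atom_def)

section \<open>Transfer to deductive sources\<close>

lemma R_sem_eq_core:
  fixes Cn :: "('s::finite) set \<Rightarrow> 's set"
  assumes b: "1 < b" and Cn: "consequence_operator Cn" and P: "set_pmf P \<subseteq> set S"
    and Shat: "Shat \<noteq> {}" "Shat \<subseteq> Cn (set S)" and "0 \<le> D"
  shows "R_sem b Cn S Shat P D =
    (if P_core Cn S P = 0 then 0
     else ereal (P_core Cn S P) * R_core b Cn S Shat P (D / P_core Cn S P))"
proof (cases "P_core Cn S P = 0")
  case True
  then have "set_pmf P \<subseteq> redundant_part Cn S"
    using P by (auto simp: P_core_def measure_pmf_zero_iff redundant_part_def)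
  \<comment> \<open>All mass sits on redundant states, which any derivable reconstruction represents
    without distortion.\<close>
  moreover obtain t where "t \<in> Shat" using Shat by blast
  ultimately show ?thesis
    unfolding R_sem_def using True Shat assms(6)
    by (simp, intro rate_distortion_eq_0[OF b, of _ t] d_Cn_redundant_part[OF Cn]) auto
next
  case False
  then show ?thesis
    unfolding R_sem_def R_core_def P_core_def pi_core_def using P Shat
    by (subst rate_distortion_cond_pmf[OF b _ Atom_subset])
      (auto intro!: d_Cn_redundant_part[OF Cn] simp: redundant_part_def)
qed

text \<open>Invisibility as invariance: the core formula sees the source only through its masses on
  the core, so moving mass among redundant states changes nothing.\<close>

lemma R_sem_cong_core:
  fixes Cn :: "('s::finite) set \<Rightarrow> 's set"
  assumes "1 < b" "consequence_operator Cn" "Shat \<noteq> {}" "Shat \<subseteq> Cn (set S)" "0 \<le> D"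
    and "set_pmf P \<subseteq> set S" "set_pmf P' \<subseteq> set S"
    and eq: "\<And>a. a \<in> Atom Cn S \<Longrightarrow> pmf P' a = pmf P a"
  shows "R_sem b Cn S Shat P' D = R_sem b Cn S Shat P D"
proof -
  have core: "P_core Cn S P' = P_core Cn S P"
    using eq by (simp add: P_core_def measure_measure_pmf_finite)
  have "pi_core Cn S P' = pi_core Cn S P" if "P_core Cn S P \<noteq> 0"
  proof (rule pmf_eqI)
    fix x
    have "set_pmf P \<inter> Atom Cn S \<noteq> {}" "set_pmf P' \<inter> Atom Cn S \<noteq> {}"
      using that core by (simp_all add: P_core_def flip: measure_pmf_zero_iff)
    then show "pmf (pi_core Cn S P') x = pmf (pi_core Cn S P) x"
      using core eq by (simp add: pi_core_def pmf_cond P_core_def)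
  qed
  with core assms show ?thesis
    by (simp add: R_sem_eq_core R_core_def)
qed


text \<open>Amenability to numerical evaluation is rendered as a convex objective, affine
  distortion, a convex set of channels and an attained minimum. Invisibility is stated per channel
  and also as invariance under redistributing the redundant mass.\<close>

theorem theoremV1:
  fixes Cn :: "('s::finite) set \<Rightarrow> 's set"
    and S :: "'s list"
    and Shat :: "'s set"
    and P :: "'s pmf"
    and b :: real
  assumes base: "1 < b"
    and Cn: "consequence_operator Cn"
    and order: "distinct S"
    and source: "set_pmf P \<subseteq> set S"
    and Shat_nonempty: "Shat \<noteq> {}"
    and Shat_derivable: "Shat \<subseteq> Cn (set S)"
  shows
    "(\<forall>D\<ge>0. R_sem b Cn S Shat P D =
        (if P_core Cn S P = 0 then 0
         else ereal (P_core Cn S P) * R_core b Cn S Shat P (D / P_core Cn S P)))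
     \<and> \<comment> \<open>(i)\<close>
     (Atom Cn S \<subseteq> Shat \<and>
      (\<forall>a1\<in>Atom Cn S. \<forall>a2\<in>Atom Cn S. a1 \<noteq> a2 \<longrightarrow>
         R_Cn Cn (set S) Shat a1 \<inter> R_Cn Cn (set S) Shat a2 = {})
      \<longrightarrow> R_sem b Cn S Shat P 0 =
        (if P_core Cn S P = 0 then 0
         else ereal (P_core Cn S P * entropy_pmf b (pi_core Cn S P))))
     \<and> \<comment> \<open>(ii), convexity and monotonicity\<close>
     (\<forall>D1\<ge>0. \<forall>D2\<ge>0. \<forall>t\<in>{0..1}.
        R_sem b Cn S Shat P (t * D1 + (1 - t) * D2)
          \<le> ereal t * R_sem b Cn S Shat P D1 + ereal (1 - t) * R_sem b Cn S Shat P D2)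
     \<and> (\<forall>D1\<ge>0. \<forall>D2\<ge>D1. R_sem b Cn S Shat P D2 \<le> R_sem b Cn S Shat P D1)
     \<and> (\<forall>D\<ge>0. feasible_channels (d_Cn Cn (set S)) P (set S) Shat D \<noteq> {} \<longrightarrow>
          (\<exists>W\<in>feasible_channels (d_Cn Cn (set S)) P (set S) Shat D.
             R_sem b Cn S Shat P D = ereal (mutual_info b P W)))
     \<and> \<comment> \<open>(ii), the core problem is a convex program with linear constraints and attained minimum\<close>
     (P_core Cn S P > 0 \<longrightarrow>
        (\<forall>V\<in>test_channels (Atom Cn S) Shat. \<forall>W\<in>test_channels (Atom Cn S) Shat. \<forall>t\<in>{0..1}.
           mix_channel t V W \<in> test_channels (Atom Cn S) Shat
           \<and> expected_distortion (d_Cn Cn (set S)) (pi_core Cn S P) (mix_channel t V W)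
             = t * expected_distortion (d_Cn Cn (set S)) (pi_core Cn S P) V
               + (1 - t) * expected_distortion (d_Cn Cn (set S)) (pi_core Cn S P) W
           \<and> mutual_info b (pi_core Cn S P) (mix_channel t V W)
             \<le> t * mutual_info b (pi_core Cn S P) V + (1 - t) * mutual_info b (pi_core Cn S P) W)
        \<and> (\<forall>D\<ge>0. feasible_channels (d_Cn Cn (set S)) (pi_core Cn S P) (Atom Cn S) Shat D \<noteq> {} \<longrightarrow>
             (\<exists>W\<in>feasible_channels (d_Cn Cn (set S)) (pi_core Cn S P) (Atom Cn S) Shat D.
                R_core b Cn S Shat P D = ereal (mutual_info b (pi_core Cn S P) W))))
     \<and> \<comment> \<open>(iii), invisibility to distortion\<close>
     (\<forall>s\<in>redundant_part Cn S. \<forall>t\<in>Shat. d_Cn Cn (set S) s t = 0)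
     \<and> (\<forall>W\<in>test_channels (set S) Shat.
          expected_distortion (d_Cn Cn (set S)) P W =
            (if P_core Cn S P = 0 then 0
             else P_core Cn S P * expected_distortion (d_Cn Cn (set S)) (pi_core Cn S P) W))
     \<and> \<comment> \<open>(iii), invisibility to rate\<close>
     (P_core Cn S P > 0 \<longrightarrow>
        (\<forall>W\<in>test_channels (set S) Shat.
           P_core Cn S P * mutual_info b (pi_core Cn S P) W \<le> mutual_info b P W)
        \<and> (\<forall>W\<in>test_channels (Atom Cn S) Shat. \<exists>V\<in>test_channels (set S) Shat.
             (\<forall>a\<in>Atom Cn S. V a = W a)
             \<and> mutual_info b P V = P_core Cn S P * mutual_info b (pi_core Cn S P) W))
     \<and> (\<forall>P'. set_pmf P' \<subseteq> set S \<and> (\<forall>a\<in>Atom Cn S. pmf P' a = pmf P a) \<longrightarrow>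
          (\<forall>D\<ge>0. R_sem b Cn S Shat P' D = R_sem b Cn S Shat P D))"
proof -
  let ?d = "d_Cn Cn (set S)" and ?A = "Atom Cn S" and ?a = "P_core Cn S P" and ?c = "pi_core Cn S P"
  note core = R_sem_eq_core[OF base Cn source Shat_nonempty Shat_derivable]
  have redundant: "?d s t = 0" if "s \<in> redundant_part Cn S" "t \<in> Shat" for s t
    using that Shat_derivable by (intro d_Cn_redundant_part[OF Cn]) auto
  have support_c: "set_pmf ?c \<subseteq> ?A" if "?a \<noteq> 0"
    using that by (simp add: pi_core_def P_core_def set_cond_pmf measure_pmf_zero_iff)
  have zero_rate: "R_sem b Cn S Shat P 0 = (if ?a = 0 then 0 else ereal (?a * entropy_pmf b ?c))"
    if sub: "?A \<subseteq> Shat"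
      and disj: "\<forall>a1\<in>?A. \<forall>a2\<in>?A. a1 \<noteq> a2 \<longrightarrow> R_Cn Cn (set S) Shat a1 \<inter> R_Cn Cn (set S) Shat a2 = {}"
  proof (cases "?a = 0")
    case False
    \<comment> \<open>A zero budget stays zero after division by \<open>?a\<close>, so only the core
      function at 0 is needed.\<close>
    have "R_core b Cn S Shat P 0 = ereal (entropy_pmf b ?c)"
      unfolding R_core_def
    proof (rule rate_distortion_zero_eq_entropy[OF base d_Cn_nonneg _ support_c[OF False] sub])
      show "a1 = a2" if "a1 \<in> ?A" "a2 \<in> ?A" "t \<in> Shat" "?d a1 t = 0" "?d a2 t = 0" for a1 a2 t
        using disj that unfolding R_Cn_def by blast
    qed (simp add: d_Cn_eq_0_if_closure_eq)
    with False show ?thesis by (simp add: core)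
  qed (simp add: core)
  have distortion: "expected_distortion ?d P W = (if ?a = 0 then 0 else ?a * expected_distortion ?d ?c W)"
    if W: "W \<in> test_channels (set S) Shat" for W
  proof -
    have zero: "?d s t = 0" if "s \<in> set_pmf P - ?A" "t \<in> set_pmf (W s)" for s t
      using that W source by (intro redundant) (auto simp: redundant_part_def test_channels_def)
    show ?thesis
    proof (cases "?a = 0")
      case True
      then have "set_pmf P \<inter> ?A = {}" by (simp add: P_core_def measure_pmf_zero_iff)
      then have "expected_distortion ?d P W = 0"
        by (intro expected_distortion_eq_0 zero) auto
      with True show ?thesis by simp
    next
      case False
      then show ?thesis
        using expected_distortion_cond_pmf[of P ?A W ?d] zero by (simp add: P_core_def pi_core_def)
    qed
  qed
  have extension: "\<exists>V\<in>test_channels (set S) Shat. (\<forall>a\<in>?A. V a = W a) \<and>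
      mutual_info b P V = ?a * mutual_info b ?c W"
    if "0 < ?a" "W \<in> test_channels ?A Shat" for W
    using that extend_channel_in_test_channels[of P ?A W Shat "set S"]
      mutual_info_extend_channel[OF base, of P ?A W]
    by (intro bexI[of _ "extend_channel P ?A W"]) (auto simp: P_core_def pi_core_def extend_channel_def)
  show ?thesis
  proof (intro conjI allI ballI impI)
    fix D1 D2 t :: real assume "t \<in> {0..1}"
    then show "R_sem b Cn S Shat P (t * D1 + (1 - t) * D2)
        \<le> ereal t * R_sem b Cn S Shat P D1 + ereal (1 - t) * R_sem b Cn S Shat P D2"
      unfolding R_sem_def by (intro rate_distortion_convex[OF base]) auto
  next
    fix D1 D2 :: real assume "D1 \<le> D2"
    then show "R_sem b Cn S Shat P D2 \<le> R_sem b Cn S Shat P D1"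
      unfolding R_sem_def by (rule rate_distortion_antimono)
  next
    fix D assume "feasible_channels ?d P (set S) Shat D \<noteq> {}"
    then show "\<exists>W\<in>feasible_channels ?d P (set S) Shat D. R_sem b Cn S Shat P D = ereal (mutual_info b P W)"
      unfolding R_sem_def by (rule rate_distortion_attained[OF base])
  next
    fix D assume "feasible_channels ?d ?c ?A Shat D \<noteq> {}"
    then show "\<exists>W\<in>feasible_channels ?d ?c ?A Shat D. R_core b Cn S Shat P D = ereal (mutual_info b ?c W)"
      unfolding R_core_def by (rule rate_distortion_attained[OF base])
  next
    fix W :: "'s \<Rightarrow> 's pmf" assume "0 < ?a"
    then show "?a * mutual_info b ?c W \<le> mutual_info b P W"
      using mutual_info_cond_pmf_le[OF base, of P ?A W] by (simp add: P_core_def pi_core_def)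
  next
    fix P' D assume "set_pmf P' \<subseteq> set S \<and> (\<forall>a\<in>?A. pmf P' a = pmf P a)" "(0::real) \<le> D"
    then show "R_sem b Cn S Shat P' D = R_sem b Cn S Shat P D"
      using source by (intro R_sem_cong_core[OF base Cn Shat_nonempty Shat_derivable]) auto
  next
    fix V W :: "'s \<Rightarrow> 's pmf" and t :: real
    assume VW: "V \<in> test_channels ?A Shat" "W \<in> test_channels ?A Shat" and "t \<in> {0..1}"
    then have t: "0 \<le> t" "t \<le> 1" by auto
    show "mix_channel t V W \<in> test_channels ?A Shat"
      using VW by (rule mix_channel_in_test_channels)
    show "expected_distortion ?d ?c (mix_channel t V W)
        = t * expected_distortion ?d ?c V + (1 - t) * expected_distortion ?d ?c W"
      using t by (rule expected_distortion_mix_channel)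
    show "mutual_info b ?c (mix_channel t V W) \<le> t * mutual_info b ?c V + (1 - t) * mutual_info b ?c W"
      using base t by (rule mutual_info_mix_channel_le)
  next
    fix D :: real assume "0 \<le> D"
    then show "R_sem b Cn S Shat P D =
        (if ?a = 0 then 0 else ereal ?a * R_core b Cn S Shat P (D / ?a))"
      by (rule core)
  next
    assume "?A \<subseteq> Shat \<and> (\<forall>a1\<in>?A. \<forall>a2\<in>?A. a1 \<noteq> a2 \<longrightarrow>
      R_Cn Cn (set S) Shat a1 \<inter> R_Cn Cn (set S) Shat a2 = {})"
    then show "R_sem b Cn S Shat P 0 = (if ?a = 0 then 0 else ereal (?a * entropy_pmf b ?c))"
      using zero_rate by (elim conjE)
  next
    fix s t assume "s \<in> redundant_part Cn S" "t \<in> Shat"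
    then show "?d s t = 0" by (rule redundant)
  next
    fix W assume "W \<in> test_channels (set S) Shat"
    then show "expected_distortion ?d P W = (if ?a = 0 then 0 else ?a * expected_distortion ?d ?c W)"
      by (rule distortion)
  next
    fix W assume "0 < ?a" "W \<in> test_channels ?A Shat"
    then show "\<exists>V\<in>test_channels (set S) Shat. (\<forall>a\<in>?A. V a = W a) \<and>
        mutual_info b P V = ?a * mutual_info b ?c W"
      by (rule extension)
  qed
qed

end
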